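(* (i) Let two reciprocal $(6,10)$ figures with vertices $\Psi,\Psi_{12},\Phi_1,\Phi_2,\Phi_{13},\Phi_{23}$ and $\Psi_1,\Psi_2,\Phi,\Phi_3,\Phi_{12},\Phi_{123}$ be given, and define the real dilations $a,b,c,d,e,a_3,b_2,c_1,d_2,e_1$ by $$\Phi_{12}-\Phi=a(\Phi_1-\Phi_2),\ \Phi_{13}-\Psi=b(\Psi_1-\Phi_3),\ \Phi_{23}-\Psi=c(\Psi_2-\Phi_3),\ \Psi_1-\Phi=d(\Phi_1-\Psi),\ \Psi_2-\Phi=e(\Phi_2-\Psi),$$ $$\Phi_{123}-\Phi_3=a_3(\Phi_{13}-\Phi_{23}),\ \Phi_{123}-\Psi_2=b_2(\Psi_{12}-\Phi_{23}),\ \Phi_{123}-\Psi_1=c_1(\Psi_{12}-\Phi_{13}),$$ $$\Psi_{12}-\Phi_2=d_2(\Phi_{12}-\Psi_2),\ \Psi_{12}-\Phi_1=e_1(\Phi_{12}-\Psi_1).$$ Then $$a_3=\frac{a}{bc(ad+ed-ea)+a(b-c)},\quad b_2=\frac{a_3(c-b)+1}{c},\quad c_1=\frac{a_3(c-b)+1}{b},\quad d_2=\frac{d}{ad+ed-ea},\quad e_1=\frac{e}{ad+ed-ea}.$$ (ii) Conversely, let $\Phi,\Phi_1,\Phi_2,\Phi_3,\Psi$ be five generic points of $\mathbb{C}$, let $a,b,c,d,e\in\mathbb{R}$ be arbitrary non-vanishing real numbers and let $a_3,b_2,c_1,d_2,e_1$ be given by the formulas above. Then the ten linear equations above are compatible,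 and the points $\Psi,\Psi_{12},\Phi_1,\Phi_2,\Phi_{13},\Phi_{23}$ and $\Psi_1,\Psi_2,\Phi,\Phi_3,\Phi_{12},\Phi_{123}$ are the vertices of two reciprocal $(6,10)$ figures. These satisfy $$Q(\Phi_1,\Phi_2,\Psi,\Psi_{12})=Q(\Psi_2,\Psi_1,\Phi_{12},\Phi),\qquad Q(\Psi_1,\Psi_2,\Phi_3,\Phi_{123})=Q(\Phi_{23},\Phi_{13},\Psi_{12},\Psi).$$
   Context: The plane is identified with $\mathbb{C}$; $Q(P_1,P_2,P_3,P_4)=\frac{(P_1-P_2)(P_3-P_4)}{(P_2-P_3)(P_4-P_1)}$. A $(6,10)$ figure (first kind) has vertices $\Psi,\Psi_{12},\Phi_1,\Phi_2,\Phi_{13},\Phi_{23}$ and the ten straight edges $\Phi_1\Phi_2$, $\Psi\Phi_1$, $\Psi\Phi_2$, $\Psi\Phi_{13}$, $\Psi\Phi_{23}$, $\Phi_{13}\Phi_{23}$, $\Psi_{12}\Phi_{13}$, $\Psi_{12}\Phi_{23}$, $\Psi_{12}\Phi_1$, $\Psi_{12}\Phi_2$ (an octahedral figure with the edges $\Phi_1\Phi_{13}$ and $\Phi_2\Phi_{23}$ removed). Its reciprocal has vertices $\Psi_1,\Psi_2,\Phi,\Phi_3,\Phi_{12},\Phi_{123}$ and ten edges; the two figures are reciprocal when the corresponding edges are parallel, the correspondence being: $\Phi\Phi_{12}\parallel\Phi_1\Phi_2$, $\Psi_1\Phi_3\parallel\Psi\Phi_{13}$, $\Psi_2\Phi_3\parallel\Psi\Phi_{23}$,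 $\Phi\Psi_1\parallel\Psi\Phi_1$, $\Phi\Psi_2\parallel\Psi\Phi_2$, $\Phi_3\Phi_{123}\parallel\Phi_{13}\Phi_{23}$, $\Psi_2\Phi_{123}\parallel\Psi_{12}\Phi_{23}$, $\Psi_1\Phi_{123}\parallel\Psi_{12}\Phi_{13}$, $\Phi_{12}\Psi_2\parallel\Psi_{12}\Phi_2$, $\Phi_{12}\Psi_1\parallel\Psi_{12}\Phi_1$ (lines meeting at a vertex in one figure then form closed polygons in the other, in Maxwell's sense). Parallelism is expressed by the real dilations in the displayed equations. *)

theory Defs
  imports Complex_Main
begin

definition Q :: "complex \<Rightarrow> complex \<Rightarrow> complex \<Rightarrow> complex \<Rightarrow> complex" where
  "Q P1 P2 P3 P4 = ((P1 - P2) * (P3 - P4)) / ((P2 - P3) * (P4 - P1))"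

definition parallel :: "complex \<Rightarrow> complex \<Rightarrow> bool" where
  "parallel z w \<longleftrightarrow> (\<exists>s t :: real. (s \<noteq> 0 \<or> t \<noteq> 0) \<and> of_real s * z + of_real t * w = 0)"

definition vertex_nondeg :: "complex \<Rightarrow> complex list \<Rightarrow> bool" where
  "vertex_nondeg p qs \<longleftrightarrow>
     (\<forall>i < length qs. \<forall>j < length qs. i \<noteq> j \<longrightarrow> \<not> parallel (qs ! i - p) (qs ! j - p))"

definition fig1_nondeg :: "complex \<Rightarrow> complex \<Rightarrow> complex \<Rightarrow> complex \<Rightarrow> complex \<Rightarrow> complex \<Rightarrow> bool" where
  "fig1_nondeg Psi Psi12 Phi1 Phi2 Phi13 Phi23 \<longleftrightarrow>
     vertex_nondeg Psi [Phi1, Phi2, Phi13, Phi23] \<and>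
     vertex_nondeg Psi12 [Phi13, Phi23, Phi1, Phi2] \<and>
     vertex_nondeg Phi1 [Phi2, Psi, Psi12] \<and>
     vertex_nondeg Phi2 [Phi1, Psi, Psi12] \<and>
     vertex_nondeg Phi13 [Psi, Phi23, Psi12] \<and>
     vertex_nondeg Phi23 [Psi, Phi13, Psi12]"

definition fig2_nondeg :: "complex \<Rightarrow> complex \<Rightarrow> complex \<Rightarrow> complex \<Rightarrow> complex \<Rightarrow> complex \<Rightarrow> bool" where
  "fig2_nondeg Psi1 Psi2 Phi Phi3 Phi12 Phi123 \<longleftrightarrow>
     vertex_nondeg Phi [Phi12, Psi1, Psi2] \<and>
     vertex_nondeg Psi1 [Phi3, Phi, Phi123, Phi12] \<and>
     vertex_nondeg Psi2 [Phi3, Phi, Phi123, Phi12] \<and>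
     vertex_nondeg Phi3 [Psi1, Psi2, Phi123] \<and>
     vertex_nondeg Phi12 [Phi, Psi2, Psi1] \<and>
     vertex_nondeg Phi123 [Phi3, Psi2, Psi1]"

definition recip_eqs ::
  "complex \<Rightarrow> complex \<Rightarrow> complex \<Rightarrow> complex \<Rightarrow> complex \<Rightarrow> complex \<Rightarrow>
   complex \<Rightarrow> complex \<Rightarrow> complex \<Rightarrow> complex \<Rightarrow> complex \<Rightarrow> complex \<Rightarrow>
   real \<Rightarrow> real \<Rightarrow> real \<Rightarrow> real \<Rightarrow> real \<Rightarrow> real \<Rightarrow> real \<Rightarrow> real \<Rightarrow> real \<Rightarrow> real \<Rightarrow> bool" where
  "recip_eqs Psi Psi12 Phi1 Phi2 Phi13 Phi23 Psi1 Psi2 Phi Phi3 Phi12 Phi123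
             a b c d e a3 b2 c1 d2 e1 \<longleftrightarrow>
     Phi12 - Phi = of_real a * (Phi1 - Phi2) \<and>
     Phi13 - Psi = of_real b * (Psi1 - Phi3) \<and>
     Phi23 - Psi = of_real c * (Psi2 - Phi3) \<and>
     Psi1 - Phi = of_real d * (Phi1 - Psi) \<and>
     Psi2 - Phi = of_real e * (Phi2 - Psi) \<and>
     Phi123 - Phi3 = of_real a3 * (Phi13 - Phi23) \<and>
     Phi123 - Psi2 = of_real b2 * (Psi12 - Phi23) \<and>
     Phi123 - Psi1 = of_real c1 * (Psi12 - Phi13) \<and>
     Psi12 - Phi2 = of_real d2 * (Phi12 - Psi2) \<and>
     Psi12 - Phi1 = of_real e1 * (Phi12 - Psi1)"

end

theory Submission
  imports Defs
begin

(* Given Phi, Phi1, Phi2, Phi3, Psi, seven of the ten parallelism equations construct the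
   remaining points from the dilations a, b, c, d, e, a3, d2; the other three close the
   quadrilateral Phi1 Psi12 Phi2 and the two triangles through Phi123. Computing Psi12 along
   both routes gives a real combination of the non-parallel edges Psi Phi1 and Psi Phi2 that
   must vanish, i.e. two linear equations for d2 and e1, whose solution yields
   D (Psi12 - Psi) = a (Psi1 - Psi2) with D = ad + ed - ea. With this, computing Phi123 along
   both routes gives real combinations of the non-parallel edges Psi Phi13 and Psi Phi23,
   i.e. linear equations for a3, b2, c1. The same identities show conversely that the
   construction closes up when the dilations are given by the formulas, and they make the
   numerators and denominators of the two Q-quotients proportional. *)

lemma parallel_0_left [simp]: "parallel 0 w"
  unfolding parallel_def by (rule exI[of _ 1], rule exI[of _ 0]) simp

lemma parallel_0_right [simp]: "parallel z 0"
  unfolding parallel_def by (rule exI[of _ 0], rule exI[of _ 1]) simp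

lemma not_parallel_nonzero:
  assumes "\<not> parallel z w"
  shows "z \<noteq> 0" "w \<noteq> 0"
  using assms by auto

lemma not_parallel_combination_eq_0:
  assumes "\<not> parallel z w" and "of_real s * z + of_real t * w = 0"
  shows "s = 0" "t = 0"
  using assms unfolding parallel_def by blast+

lemma vertex_nondeg_not_parallel:
  "vertex_nondeg p qs \<Longrightarrow> i < length qs \<Longrightarrow> j < length qs \<Longrightarrow> i \<noteq> j
    \<Longrightarrow> \<not> parallel (qs ! i - p) (qs ! j - p)"
  unfolding vertex_nondeg_def by blast

lemma divide_eq_divide_if_proportional:
  fixes n1 d1 n2 d2 :: "'a :: field"
  assumes "k1 \<noteq> 0" "k2 \<noteq> 0" "k1 * n1 = k2 * n2" "k1 * d1 = k2 * d2"
  shows "n1 / d1 = n2 / d2"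
proof -
  have "n1 / d1 = (k1 * n1) / (k1 * d1)" using assms(1) by simp
  also have "\<dots> = (k2 * n2) / (k2 * d2)" using assms(3,4) by simp
  also have "\<dots> = n2 / d2" using assms(2) by simp
  finally show ?thesis .
qed

lemma dilation_formulas_iff_relations:
  fixes a b c d e a3 b2 c1 d2 e1 :: real
  assumes D: "D = a * d + e * d - e * a" and N: "N = b * c * D + a * (b - c)"
    and "D \<noteq> 0" "N \<noteq> 0" "b \<noteq> 0" "c \<noteq> 0"
  shows "(a3 = a / N \<and> b2 = (a3 * (c - b) + 1) / c \<and> c1 = (a3 * (c - b) + 1) / b \<and>
          d2 = d / D \<and> e1 = e / D)
     \<longleftrightarrow> (N * a3 = a \<and> N * b2 = b * D \<and> N * c1 = c * D \<and> D * d2 = d \<and> D * e1 = e)"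
proof -
  have a3: "a3 = a / N \<longleftrightarrow> N * a3 = a"
    using \<open>N \<noteq> 0\<close> by (auto simp: field_simps)
  have b2_c1: "b2 = (a3 * (c - b) + 1) / c \<longleftrightarrow> N * b2 = b * D"
    "c1 = (a3 * (c - b) + 1) / b \<longleftrightarrow> N * c1 = c * D" if "N * a3 = a"
  proof -
    have "N * (a3 * (c - b) + 1) = (N * a3) * (c - b) + N" by (simp add: algebra_simps)
    also have "\<dots> = a * (c - b) + N" using that by simp
    also have "\<dots> = b * c * D" using N by (simp add: algebra_simps)
    finally have "a3 * (c - b) + 1 = b * c * D / N" using \<open>N \<noteq> 0\<close> by (simp add: field_simps)
    then have quotients: "(a3 * (c - b) + 1) / c = b * D / N" "(a3 * (c - b) + 1) / b = c * D / N"
      using \<open>b \<noteq> 0\<close> \<open>c \<noteq> 0\<close> by simp_all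
    show "b2 = (a3 * (c - b) + 1) / c \<longleftrightarrow> N * b2 = b * D"
      "c1 = (a3 * (c - b) + 1) / b \<longleftrightarrow> N * c1 = c * D"
      unfolding quotients using \<open>N \<noteq> 0\<close> by (auto simp: field_simps)
  qed
  have "d2 = d / D \<longleftrightarrow> D * d2 = d" "e1 = e / D \<longleftrightarrow> D * e1 = e"
    using \<open>D \<noteq> 0\<close> by (auto simp: field_simps)
  with a3 b2_c1 show ?thesis by blast
qed

lemma of_real_mult_diff_eq_0_imp_eq:
  "(of_real k :: complex) * (z - w) = 0 \<Longrightarrow> k \<noteq> 0 \<Longrightarrow> z = w"
  by simp

locale reciprocal_construction =
  fixes Psi Psi12 Phi1 Phi2 Phi13 Phi23 Psi1 Psi2 Phi Phi3 Phi12 Phi123 :: complex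
    and a b c d e a3 d2 :: real
  assumes Phi12_eq: "Phi12 = Phi + of_real a * (Phi1 - Phi2)"
    and Phi13_eq: "Phi13 = Psi + of_real b * (Psi1 - Phi3)"
    and Phi23_eq: "Phi23 = Psi + of_real c * (Psi2 - Phi3)"
    and Psi1_eq: "Psi1 = Phi + of_real d * (Phi1 - Psi)"
    and Psi2_eq: "Psi2 = Phi + of_real e * (Phi2 - Psi)"
    and Phi123_via_Phi3: "Phi123 = Phi3 + of_real a3 * (Phi13 - Phi23)"
    and Psi12_via_Phi2: "Psi12 = Phi2 + of_real d2 * (Phi12 - Psi2)"
begin

abbreviation D :: real where "D \<equiv> a * d + e * d - e * a"

abbreviation N :: real where "N \<equiv> b * c * D + a * (b - c)"

lemma Psi12_minus_Psi:
  assumes "D * d2 = d"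
  shows "of_real D * (Psi12 - Psi) = of_real a * (Psi1 - Psi2)"
proof -
  have "of_real D * (Psi12 - Psi) = of_real D * (Phi2 - Psi) + of_real (D * d2) * (Phi12 - Psi2)"
    by (simp add: Psi12_via_Phi2 algebra_simps)
  also have "\<dots> = of_real a * (Psi1 - Psi2)"
    unfolding assms by (simp add: Phi12_eq Psi1_eq Psi2_eq algebra_simps)
  finally show ?thesis .
qed

lemma closes_at_Phi1:
  assumes "D * d2 = d" "D * e1 = e" "D \<noteq> 0"
  shows "Psi12 = Phi1 + of_real e1 * (Phi12 - Psi1)"
proof -
  have "of_real D * (Psi12 - (Phi1 + of_real e1 * (Phi12 - Psi1)))
      = of_real D * (Psi12 - Psi) - of_real D * (Phi1 - Psi) - of_real (D * e1) * (Phi12 - Psi1)"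
    by (simp add: algebra_simps)
  also have "\<dots> = 0"
    unfolding assms(2) Psi12_minus_Psi[OF assms(1)]
    by (simp add: Phi12_eq Psi1_eq Psi2_eq algebra_simps)
  finally show ?thesis by (rule of_real_mult_diff_eq_0_imp_eq) (use assms(3) in simp)
qed

lemma closes_at_Psi2:
  assumes "D * d2 = d" "N * a3 = a" "N * b2 = b * D" "N \<noteq> 0" "c \<noteq> 0"
  shows "Phi123 = Psi2 + of_real b2 * (Psi12 - Phi23)"
proof -
  have "of_real (c * N) * (Phi123 - (Psi2 + of_real b2 * (Psi12 - Phi23)))
      = of_real c * of_real (N * a3) * (Phi13 - Phi23) + of_real (c * N) * (Phi3 - Psi2)
        - of_real c * of_real (N * b2) * (Psi12 - Phi23)"
    by (simp add: Phi123_via_Phi3 algebra_simps)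
  also have "\<dots> = of_real (c * a) * (Phi13 - Phi23) + of_real (c * N) * (Phi3 - Psi2)
        - of_real (c * b) * (of_real D * (Psi12 - Psi)) + of_real (b * c * D) * (Phi23 - Psi)"
    unfolding assms(2,3) by (simp add: algebra_simps)
  also have "\<dots> = 0"
    unfolding Psi12_minus_Psi[OF assms(1)] by (simp add: Phi13_eq Phi23_eq algebra_simps)
  finally show ?thesis by (rule of_real_mult_diff_eq_0_imp_eq) (use assms(4,5) in simp)
qed

lemma closes_at_Psi1:
  assumes "D * d2 = d" "N * a3 = a" "N * c1 = c * D" "N \<noteq> 0" "b \<noteq> 0"
  shows "Phi123 = Psi1 + of_real c1 * (Psi12 - Phi13)"
proof -
  have "of_real (b * N) * (Phi123 - (Psi1 + of_real c1 * (Psi12 - Phi13)))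
      = of_real b * of_real (N * a3) * (Phi13 - Phi23) + of_real (b * N) * (Phi3 - Psi1)
        - of_real b * of_real (N * c1) * (Psi12 - Phi13)"
    by (simp add: Phi123_via_Phi3 algebra_simps)
  also have "\<dots> = of_real (b * a) * (Phi13 - Phi23) + of_real (b * N) * (Phi3 - Psi1)
        - of_real (b * c) * (of_real D * (Psi12 - Psi)) + of_real (b * c * D) * (Phi13 - Psi)"
    unfolding assms(2,3) by (simp add: algebra_simps)
  also have "\<dots> = 0"
    unfolding Psi12_minus_Psi[OF assms(1)] by (simp add: Phi13_eq Phi23_eq algebra_simps)
  finally show ?thesis by (rule of_real_mult_diff_eq_0_imp_eq) (use assms(4,5) in simp)
qed

end

locale reciprocal_figures = reciprocal_construction +
  fixes b2 c1 e1 :: real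
  assumes Phi123_via_Psi2: "Phi123 = Psi2 + of_real b2 * (Psi12 - Phi23)"
    and Phi123_via_Psi1: "Phi123 = Psi1 + of_real c1 * (Psi12 - Phi13)"
    and Psi12_via_Phi1: "Psi12 = Phi1 + of_real e1 * (Phi12 - Psi1)"
begin

lemma d2_e1_relations:
  assumes "\<not> parallel (Phi1 - Psi) (Phi2 - Psi)"
  shows "D * d2 = d" "D * e1 = e"
proof -
  have "of_real (a * d2 - (a - d) * e1 - 1) * (Phi1 - Psi)
      + of_real (1 - (a + e) * d2 + a * e1) * (Phi2 - Psi)
      = (Phi2 + of_real d2 * (Phi12 - Psi2)) - (Phi1 + of_real e1 * (Phi12 - Psi1))"
    by (simp add: Phi12_eq Psi1_eq Psi2_eq algebra_simps)
  also have "\<dots> = 0"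
    using Psi12_via_Phi1 Psi12_via_Phi2 by simp
  finally have "a * d2 - (a - d) * e1 - 1 = 0" "1 - (a + e) * d2 + a * e1 = 0"
    using not_parallel_combination_eq_0[OF assms] by blast+
  then have first: "a * d2 - (a - d) * e1 = 1" and cross: "e * d2 - d * e1 = 0"
    by (simp_all add: algebra_simps)
  have "D * d2 = d * (a * d2 - (a - d) * e1) + (d - a) * (e * d2 - d * e1)"
    by (simp add: algebra_simps)
  then show "D * d2 = d" using first cross by simp
  have "D * e1 = e * (a * d2 - (a - d) * e1) + a * (d * e1 - e * d2)"
    by (simp add: algebra_simps)
  then show "D * e1 = e" using first cross by simp
qed

lemma Phi123_routes_via_Psi2:
  assumes "D * d2 = d"
  shows "of_real (b * c * D * a3 - a * c * b2) * (Phi13 - Psi)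
      + of_real (a * b * b2 + b * c * D * b2 - b * c * D * a3 - b * D) * (Phi23 - Psi) = 0"
proof -
  have "of_real (b * c * D * a3 - a * c * b2) * (Phi13 - Psi)
      + of_real (a * b * b2 + b * c * D * b2 - b * c * D * a3 - b * D) * (Phi23 - Psi)
      = of_real (b * c * D) * (Phi3 - Psi2 + of_real a3 * (Phi13 - Phi23) + of_real b2 * (Phi23 - Psi))
        - of_real (b * c * b2) * (of_real D * (Psi12 - Psi))"
    unfolding Psi12_minus_Psi[OF assms] by (simp add: Phi13_eq Phi23_eq algebra_simps)
  also have "\<dots> = of_real (b * c * D) * ((Phi3 + of_real a3 * (Phi13 - Phi23))
      - (Psi2 + of_real b2 * (Psi12 - Phi23)))"
    by (simp add: algebra_simps)
  also have "\<dots> = 0"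
    using Phi123_via_Phi3 Phi123_via_Psi2 by simp
  finally show ?thesis .
qed

lemma Phi123_routes_via_Psi1:
  assumes "D * d2 = d"
  shows "of_real (b * c * D * a3 - a * c * c1 + b * c * D * c1 - c * D) * (Phi13 - Psi)
      + of_real (a * b * c1 - b * c * D * a3) * (Phi23 - Psi) = 0"
proof -
  have "of_real (b * c * D * a3 - a * c * c1 + b * c * D * c1 - c * D) * (Phi13 - Psi)
      + of_real (a * b * c1 - b * c * D * a3) * (Phi23 - Psi)
      = of_real (b * c * D) * (Phi3 - Psi1 + of_real a3 * (Phi13 - Phi23) + of_real c1 * (Phi13 - Psi))
        - of_real (b * c * c1) * (of_real D * (Psi12 - Psi))"
    unfolding Psi12_minus_Psi[OF assms] by (simp add: Phi13_eq Phi23_eq algebra_simps)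
  also have "\<dots> = of_real (b * c * D) * ((Phi3 + of_real a3 * (Phi13 - Phi23))
      - (Psi1 + of_real c1 * (Psi12 - Phi13)))"
    by (simp add: algebra_simps)
  also have "\<dots> = 0"
    using Phi123_via_Phi3 Phi123_via_Psi1 by simp
  finally show ?thesis .
qed

lemma a3_b2_c1_relations:
  assumes "D * d2 = d" "D \<noteq> 0" "\<not> parallel (Phi13 - Psi) (Phi23 - Psi)"
  shows "N * a3 = a" "N * b2 = b * D" "N * c1 = c * D"
proof -
  have "b \<noteq> 0" "c \<noteq> 0"
    using not_parallel_nonzero[OF assms(3)] Phi13_eq Phi23_eq by auto
  have b2_Phi13: "b * c * D * a3 - a * c * b2 = 0"
    and b2_Phi23: "a * b * b2 + b * c * D * b2 - b * c * D * a3 - b * D = 0"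
    using not_parallel_combination_eq_0[OF assms(3) Phi123_routes_via_Psi2[OF assms(1)]] by blast+
  have c1_Phi13: "b * c * D * a3 - a * c * c1 + b * c * D * c1 - c * D = 0"
    and c1_Phi23: "a * b * c1 - b * c * D * a3 = 0"
    using not_parallel_combination_eq_0[OF assms(3) Phi123_routes_via_Psi1[OF assms(1)]] by blast+
  show "N * b2 = b * D"
    using b2_Phi13 b2_Phi23 by (simp add: algebra_simps)
  show Nc1: "N * c1 = c * D"
    using c1_Phi13 c1_Phi23 by (simp add: algebra_simps)
  have "b * (c * D * a3 - a * c1) = 0"
    using c1_Phi23 by (simp add: algebra_simps)
  then have "c * D * a3 = a * c1"
    using \<open>b \<noteq> 0\<close> by simp
  then have "c * D * (N * a3) = c * D * a"
    by (metis Nc1 mult.assoc mult.commute)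
  then show "N * a3 = a"
    using \<open>c \<noteq> 0\<close> assms(2) by simp
qed

lemma dilations_determined:
  assumes "\<not> parallel (Phi1 - Psi) (Phi2 - Psi)" "\<not> parallel (Phi13 - Psi) (Phi23 - Psi)"
    and "\<not> parallel (Phi12 - Phi) (Psi2 - Phi)"
  shows "a3 = a / N \<and> b2 = (a3 * (c - b) + 1) / c \<and> c1 = (a3 * (c - b) + 1) / b \<and>
         d2 = d / D \<and> e1 = e / D"
proof -
  have "a \<noteq> 0" "e \<noteq> 0"
    using not_parallel_nonzero[OF assms(3)] Phi12_eq Psi2_eq by auto
  have "b \<noteq> 0" "c \<noteq> 0"
    using not_parallel_nonzero[OF assms(2)] Phi13_eq Phi23_eq by auto
  have Dd2: "D * d2 = d" and De1: "D * e1 = e"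
    using d2_e1_relations[OF assms(1)] by blast+
  with \<open>e \<noteq> 0\<close> have "D \<noteq> 0" by auto
  have Na3: "N * a3 = a" and "N * b2 = b * D" "N * c1 = c * D"
    using a3_b2_c1_relations[OF Dd2 \<open>D \<noteq> 0\<close> assms(2)] by blast+
  moreover from Na3 \<open>a \<noteq> 0\<close> have "N \<noteq> 0" by auto
  ultimately show ?thesis
    using dilation_formulas_iff_relations[OF refl refl \<open>D \<noteq> 0\<close> \<open>N \<noteq> 0\<close> \<open>b \<noteq> 0\<close> \<open>c \<noteq> 0\<close>]
      Dd2 De1 by blast
qed

lemma Q_Phi1_Phi2_Psi_Psi12:
  assumes "D * d2 = d" "D * e1 = e" "D \<noteq> 0"
  shows "Q Phi1 Phi2 Psi Psi12 = Q Psi2 Psi1 Phi12 Phi"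
  unfolding Q_def
proof (rule divide_eq_divide_if_proportional)
  show "(of_real D :: complex) \<noteq> 0" "(1 :: complex) \<noteq> 0"
    using assms(3) by (metis of_real_eq_0_iff) simp
  have "of_real D * ((Phi1 - Phi2) * (Psi - Psi12)) = - (Phi1 - Phi2) * (of_real D * (Psi12 - Psi))"
    by (simp add: algebra_simps)
  also have "\<dots> = 1 * ((Psi2 - Psi1) * (Phi12 - Phi))"
    unfolding Psi12_minus_Psi[OF assms(1)] by (simp add: Phi12_eq algebra_simps)
  finally show "of_real D * ((Phi1 - Phi2) * (Psi - Psi12)) = 1 * ((Psi2 - Psi1) * (Phi12 - Phi))" .
  have "of_real D * ((Phi2 - Psi) * (Psi12 - Phi1)) = (Phi2 - Psi) * of_real (D * e1) * (Phi12 - Psi1)"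
    by (simp add: Psi12_via_Phi1)
  also have "\<dots> = 1 * ((Psi1 - Phi12) * (Phi - Psi2))"
    unfolding assms(2) by (simp add: Psi2_eq algebra_simps)
  finally show "of_real D * ((Phi2 - Psi) * (Psi12 - Phi1)) = 1 * ((Psi1 - Phi12) * (Phi - Psi2))" .
qed

lemma Q_Psi1_Psi2_Phi3_Phi123:
  assumes "D * d2 = d" "N * a3 = a" "N * c1 = c * D" "D \<noteq> 0" "N \<noteq> 0"
  shows "Q Psi1 Psi2 Phi3 Phi123 = Q Phi23 Phi13 Psi12 Psi"
  unfolding Q_def
proof (rule divide_eq_divide_if_proportional)
  show "(of_real N :: complex) \<noteq> 0" "(of_real D :: complex) \<noteq> 0"
    using assms(4,5) by (metis of_real_eq_0_iff)+
  have "of_real N * ((Psi1 - Psi2) * (Phi3 - Phi123))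
      = - (Psi1 - Psi2) * of_real (N * a3) * (Phi13 - Phi23)"
    by (simp add: Phi123_via_Phi3 algebra_simps)
  also have "\<dots> = of_real D * ((Phi23 - Phi13) * (Psi12 - Psi))"
    unfolding assms(2) mult.left_commute[of "of_real D"] Psi12_minus_Psi[OF assms(1)]
    by (simp add: algebra_simps)
  finally show "of_real N * ((Psi1 - Psi2) * (Phi3 - Phi123))
      = of_real D * ((Phi23 - Phi13) * (Psi12 - Psi))" .
  have "of_real N * ((Psi2 - Phi3) * (Phi123 - Psi1))
      = (Psi2 - Phi3) * of_real (N * c1) * (Psi12 - Phi13)"
    by (simp add: Phi123_via_Psi1)
  also have "\<dots> = of_real D * ((Phi13 - Psi12) * (Psi - Phi23))"
    unfolding assms(3) by (simp add: Phi23_eq algebra_simps)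
  finally show "of_real N * ((Psi2 - Phi3) * (Phi123 - Psi1))
      = of_real D * ((Phi13 - Psi12) * (Psi - Phi23))" .
qed

end

lemma recip_eqs_iff_reciprocal_figures:
  "recip_eqs Psi Psi12 Phi1 Phi2 Phi13 Phi23 Psi1 Psi2 Phi Phi3 Phi12 Phi123 a b c d e a3 b2 c1 d2 e1
   \<longleftrightarrow> reciprocal_figures Psi Psi12 Phi1 Phi2 Phi13 Phi23 Psi1 Psi2 Phi Phi3 Phi12 Phi123
         a b c d e a3 d2 b2 c1 e1"
  unfolding recip_eqs_def reciprocal_figures_def reciprocal_construction_def
    reciprocal_figures_axioms_def
  by (auto simp: algebra_simps)

lemma ex_reciprocal_figures:
  fixes a b c d e a3 b2 c1 d2 e1 :: real
  assumes D: "D = a * d + e * d - e * a" and N: "N = b * c * D + a * (b - c)"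
    and "D \<noteq> 0" "N \<noteq> 0" "b \<noteq> 0" "c \<noteq> 0"
    and "N * a3 = a" "N * b2 = b * D" "N * c1 = c * D" "D * d2 = d" "D * e1 = e"
  shows "\<exists>Psi12 Phi13 Phi23 Psi1 Psi2 Phi12 Phi123.
           reciprocal_figures Psi Psi12 Phi1 Phi2 Phi13 Phi23 Psi1 Psi2 Phi Phi3 Phi12 Phi123
             a b c d e a3 d2 b2 c1 e1"
proof -
  define Psi1 where "Psi1 = Phi + of_real d * (Phi1 - Psi)"
  define Psi2 where "Psi2 = Phi + of_real e * (Phi2 - Psi)"
  define Phi12 where "Phi12 = Phi + of_real a * (Phi1 - Phi2)"
  define Phi13 where "Phi13 = Psi + of_real b * (Psi1 - Phi3)"
  define Phi23 where "Phi23 = Psi + of_real c * (Psi2 - Phi3)"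
  define Phi123 where "Phi123 = Phi3 + of_real a3 * (Phi13 - Phi23)"
  define Psi12 where "Psi12 = Phi2 + of_real d2 * (Phi12 - Psi2)"
  interpret reciprocal_construction Psi Psi12 Phi1 Phi2 Phi13 Phi23 Psi1 Psi2 Phi Phi3 Phi12 Phi123
    a b c d e a3 d2
    by unfold_locales (simp_all add: Psi1_def Psi2_def Phi12_def Phi13_def Phi23_def Phi123_def Psi12_def)
  have "reciprocal_figures Psi Psi12 Phi1 Phi2 Phi13 Phi23 Psi1 Psi2 Phi Phi3 Phi12 Phi123
      a b c d e a3 d2 b2 c1 e1"
  proof unfold_locales
    show "Phi123 = Psi2 + of_real b2 * (Psi12 - Phi23)"
      using closes_at_Psi2 assms(3-) unfolding N D by blast
    show "Phi123 = Psi1 + of_real c1 * (Psi12 - Phi13)"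
      using closes_at_Psi1 assms(3-) unfolding N D by blast
    show "Psi12 = Phi1 + of_real e1 * (Phi12 - Psi1)"
      using closes_at_Phi1 assms(3-) unfolding D by blast
  qed
  then show ?thesis by blast
qed

lemma dilations_of_reciprocal_figures:
  assumes fig1: "fig1_nondeg Psi Psi12 Phi1 Phi2 Phi13 Phi23"
    and fig2: "fig2_nondeg Psi1 Psi2 Phi Phi3 Phi12 Phi123"
    and "recip_eqs Psi Psi12 Phi1 Phi2 Phi13 Phi23 Psi1 Psi2 Phi Phi3 Phi12 Phi123
      a b c d e a3 b2 c1 d2 e1"
  shows "a3 = a / (b * c * (a * d + e * d - e * a) + a * (b - c)) \<and>
    b2 = (a3 * (c - b) + 1) / c \<and> c1 = (a3 * (c - b) + 1) / b \<and>
    d2 = d / (a * d + e * d - e * a) \<and> e1 = e / (a * d + e * d - e * a)"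
proof -
  interpret reciprocal_figures Psi Psi12 Phi1 Phi2 Phi13 Phi23 Psi1 Psi2 Phi Phi3 Phi12 Phi123
    a b c d e a3 d2 b2 c1 e1
    using assms(3) by (simp add: recip_eqs_iff_reciprocal_figures)
  have "\<not> parallel (Phi1 - Psi) (Phi2 - Psi)" "\<not> parallel (Phi13 - Psi) (Phi23 - Psi)"
    using fig1 vertex_nondeg_not_parallel[of Psi "[Phi1, Phi2, Phi13, Phi23]" 0 1]
      vertex_nondeg_not_parallel[of Psi "[Phi1, Phi2, Phi13, Phi23]" 2 3]
    by (simp_all add: fig1_nondeg_def)
  moreover have "\<not> parallel (Phi12 - Phi) (Psi2 - Phi)"
    using fig2 vertex_nondeg_not_parallel[of Phi "[Phi12, Psi1, Psi2]" 0 2]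
    by (simp add: fig2_nondeg_def)
  ultimately show ?thesis by (rule dilations_determined)
qed

lemma reciprocal_figures_of_dilations:
  fixes a b c d e a3 b2 c1 d2 e1 :: real
  assumes "b \<noteq> 0" "c \<noteq> 0"
    and D: "a * d + e * d - e * a \<noteq> 0"
    and N: "b * c * (a * d + e * d - e * a) + a * (b - c) \<noteq> 0"
    and "a3 = a / (b * c * (a * d + e * d - e * a) + a * (b - c))"
    and "b2 = (a3 * (c - b) + 1) / c" "c1 = (a3 * (c - b) + 1) / b"
    and "d2 = d / (a * d + e * d - e * a)" "e1 = e / (a * d + e * d - e * a)"
  shows "\<exists>Psi12 Phi13 Phi23 Psi1 Psi2 Phi12 Phi123.
    recip_eqs Psi Psi12 Phi1 Phi2 Phi13 Phi23 Psi1 Psi2 Phi Phi3 Phi12 Phi123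
      a b c d e a3 b2 c1 d2 e1 \<and>
    Q Phi1 Phi2 Psi Psi12 = Q Psi2 Psi1 Phi12 Phi \<and>
    Q Psi1 Psi2 Phi3 Phi123 = Q Phi23 Phi13 Psi12 Psi"
proof -
  have relations: "(b * c * (a * d + e * d - e * a) + a * (b - c)) * a3 = a"
    "(b * c * (a * d + e * d - e * a) + a * (b - c)) * b2 = b * (a * d + e * d - e * a)"
    "(b * c * (a * d + e * d - e * a) + a * (b - c)) * c1 = c * (a * d + e * d - e * a)"
    "(a * d + e * d - e * a) * d2 = d" "(a * d + e * d - e * a) * e1 = e"
    using dilation_formulas_iff_relations[OF refl refl D N assms(1,2)] assms(5-) by blast+
  obtain Psi12 Phi13 Phi23 Psi1 Psi2 Phi12 Phi123 where figures:
    "reciprocal_figures Psi Psi12 Phi1 Phi2 Phi13 Phi23 Psi1 Psi2 Phi Phi3 Phi12 Phi123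
       a b c d e a3 d2 b2 c1 e1"
    using ex_reciprocal_figures[OF refl refl D N assms(1,2) relations] by blast
  then interpret reciprocal_figures Psi Psi12 Phi1 Phi2 Phi13 Phi23 Psi1 Psi2 Phi Phi3 Phi12 Phi123
    a b c d e a3 d2 b2 c1 e1 .
  show ?thesis
  proof (intro exI conjI)
    show "recip_eqs Psi Psi12 Phi1 Phi2 Phi13 Phi23 Psi1 Psi2 Phi Phi3 Phi12 Phi123
        a b c d e a3 b2 c1 d2 e1"
      using figures by (simp add: recip_eqs_iff_reciprocal_figures)
    show "Q Phi1 Phi2 Psi Psi12 = Q Psi2 Psi1 Phi12 Phi"
      using relations D by (intro Q_Phi1_Phi2_Psi_Psi12)
    show "Q Psi1 Psi2 Phi3 Phi123 = Q Phi23 Phi13 Psi12 Psi"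
      using relations D N by (intro Q_Psi1_Psi2_Phi3_Phi123)
  qed
qed

theorem theorem5:
  shows
  "(\<forall>Psi Psi12 Phi1 Phi2 Phi13 Phi23 Psi1 Psi2 Phi Phi3 Phi12 Phi123
       (a::real) b c d e a3 b2 c1 d2 e1.
      fig1_nondeg Psi Psi12 Phi1 Phi2 Phi13 Phi23 \<and>
      fig2_nondeg Psi1 Psi2 Phi Phi3 Phi12 Phi123 \<and>
      recip_eqs Psi Psi12 Phi1 Phi2 Phi13 Phi23 Psi1 Psi2 Phi Phi3 Phi12 Phi123
                a b c d e a3 b2 c1 d2 e1
      \<longrightarrow> a3 = a / (b * c * (a * d + e * d - e * a) + a * (b - c)) \<and>
          b2 = (a3 * (c - b) + 1) / c \<and>
          c1 = (a3 * (c - b) + 1) / b \<and>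
          d2 = d / (a * d + e * d - e * a) \<and>
          e1 = e / (a * d + e * d - e * a))
   \<and>
   (\<forall>Phi Phi1 Phi2 Phi3 Psi (a::real) b c d e a3 b2 c1 d2 e1.
      a \<noteq> 0 \<and> b \<noteq> 0 \<and> c \<noteq> 0 \<and> d \<noteq> 0 \<and> e \<noteq> 0 \<and>
      a * d + e * d - e * a \<noteq> 0 \<and>
      b * c * (a * d + e * d - e * a) + a * (b - c) \<noteq> 0 \<and>
      a3 = a / (b * c * (a * d + e * d - e * a) + a * (b - c)) \<and>
      b2 = (a3 * (c - b) + 1) / c \<and>
      c1 = (a3 * (c - b) + 1) / b \<and>
      d2 = d / (a * d + e * d - e * a) \<and>
      e1 = e / (a * d + e * d - e * a)
      \<longrightarrow> (\<exists>Psi12 Phi13 Phi23 Psi1 Psi2 Phi12 Phi123.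
             recip_eqs Psi Psi12 Phi1 Phi2 Phi13 Phi23 Psi1 Psi2 Phi Phi3 Phi12 Phi123
                       a b c d e a3 b2 c1 d2 e1 \<and>
             Q Phi1 Phi2 Psi Psi12 = Q Psi2 Psi1 Phi12 Phi \<and>
             Q Psi1 Psi2 Phi3 Phi123 = Q Phi23 Phi13 Psi12 Psi))"
  by (rule conjI; intro allI impI; elim conjE)
    (rule dilations_of_reciprocal_figures reciprocal_figures_of_dilations; assumption)+

end
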